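(* Let a partially ordered integration structure be given with Riesz spaces $X,Y,Z$, where $\mathcal H$ is a $\sigma$-algebra of subsets of $\Omega$ and integrals with values in $Z$ are taken with respect to $(D)$-convergence. Let $Z$ be Dedekind complete and weakly $\sigma$-distributive, let $\mu:\mathcal H\to Y^+$ be a regular integrator, and let $\{f_n\}_{n\in\mathbb N}$ be a sequence of functions $f_n:\Omega\to X$ that are net Riemann integrable on $\Omega$ with respect to $\mu$. If $f_n$ converges order uniformly to $f:\Omega\to X$, then $f$ is net Riemann integrable (on $\Omega$) with respect to $\mu$ and $$\int_\Omega f_n\,d\mu\xrightarrow{\ o\ }\int_\Omega f\,d\mu,$$ the last convergence being order convergence in $Z$.
   Context: A net convergence structure $\eta$ on a set $V$ assigns to each $v\in V$ a class of nets in $V$ ("converging to $v$") such that: (i) constant nets $v$ converge to $v$; (ii) every quasi-subnet of a net converging to $v$ converges to $v$, where $(y_j)_{j\in J}$ is a quasi-subnet of $(x_i)_{i\in I}$ if for every $i_0$ there is $j_0$ with $\{y_j:j\ge j_0\}\subseteq\{x_i:i\ge i_0\}$; (iii) if $(x_i)_{i\in I},(y_i)_{i\in I}$ converge to $v$ and $z_i\in\{x_i,y_i\}$ for all $i$, then $(z_i)$ converges to $v$. Standing assumptions: real vector spaces, Archimedean Riesz spaces, Hausdorff structures (unique limits), continuous addition and multiplication by fixed reals; on Riesz spaces the structure is locally solid: if $y_l\to0$ and $(x_i)$ is a net such that for every $l_0$ there is $i_0$ such that for every $i\ge i_0$ there is $l\ge l_0$ with $|x_i|\le|y_l|$, then $x_i\to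 0$. A partially ordered integration structure consists of: a set $\Omega$ with a class $\mathcal H$ of subsets (here a $\sigma$-algebra); for each $A\in\mathcal H$ a net $\{(\sigma_\gamma,\tau_\gamma)\}_{\gamma\in\Gamma(A)}$, where $\Gamma(A)$ is a directed set and $\sigma_\gamma=\{\sigma_{\gamma_i}\}_{i\in I_\gamma}$, $\tau_\gamma=\{\tau_{\gamma_i}\}_{i\in I_\gamma}$ are finite families in $\mathcal H$ and $\Omega$; Riesz spaces $(X,\eta_1),(Y,\eta_2),(Z,\eta_3)$ with net convergence structures; and a bilinear product $\bullet:X\times Y\to Z$ (juxtaposition), i.e. a bilinear map, continuous in each argument separately, isotone on $X^+\times Y^+$, with $\sup_n(x_n\bullet y)=(\sup_n x_n)\bullet y$ and $\sup_n(x\bullet y_n)=x\bullet(\sup_n y_n)$ for $x\in X^+$, $y\in Y^+$ and nonnegative sequences whose suprema exist. Here $\eta_3$ is $(D)$-convergence. The net Riemann integral is $\int_A f\,d\mu=\lim_{\gamma\in\Gamma(A)}\sum_{i\in I_\gamma}f(\tau_{\gamma_i})\mu(\sigma_{\gamma_i})$ when the limit exists. Convention: the nets consist of sets such that $\sum_{i\in I_\gamma}\mu(\sigma_{\gamma_i})=\mu(\bigcup_{i\in I_\gamma}\sigma_{\gamma_i})$ for $\mu$ finitely additive. A $(D)$-sequence is a double sequence $\{a_{ij}\}$ with $a_{ij}\ge a_{i,j+1}$ and $\bigwedge_j a_{ij}=0$ for all $i$. A net $(x_i)$ $(D)$-converges to $x$ if there is a $(D)$-sequence $\{a_{ij}\}$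 such that for every $\varphi\in\mathbb N^{\mathbb N}$ there is $i_0$ with $|x_i-x|\le\bigvee_{j}a_{j\varphi(j)}$ for $i\ge i_0$ (suprema understood to exist, $(D)$-sequences being bounded). $Z$ is weakly $\sigma$-distributive if $\bigwedge_{\varphi\in\mathbb N^{\mathbb N}}\bigvee_i a_{i\varphi(i)}=0$ for every $(D)$-sequence; Dedekind complete if every set bounded above has a supremum. A sequence $z_n$ order converges to $z$ if there is $w_n\downarrow0$ with $|z_n-z|\le w_n$ for all $n$. $f_n\to f$ order uniformly if there is a non-increasing sequence $u_n\downarrow0$ in $X$ with $|f_n(\omega)-f(\omega)|\le u_n$ for all $\omega\in\Omega$ and $n$. $\mu$ is a regular integrator if $\int_A\mathbf 1_\Omega\,d\mu=\mu(A)$ and $\int_\Omega\mathbf 1_A\,d\mu=\mu(A)$ for each $A\in\mathcal H$ (real indicator functions, scalar multiplication $\mathbb R\times Y\to Y$, limits in $Y$). *)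

theory Defs
  imports
    "HOL-Analysis.Analysis"
    "HOL-Library.Lattice_Algebras"
    "HOL-Library.Lub_Glb"
begin

section \<open>Riesz spaces\<close>

class archimedean_riesz_space = ordered_real_vector + lattice_ab_group_add_abs +
  assumes archimedean_riesz: "(\<And>n::nat. real n *\<^sub>R x \<le> y) \<Longrightarrow> x \<le> 0"

text \<open>Dedekind completeness is the additional sort constraint
  \<^class>\<open>conditionally_complete_lattice\<close>. Outside that class, suprema and infima are expressed by
  \<^const>\<open>isLub\<close> and \<^const>\<open>isGlb\<close>, so that existence is part of the assertion.\<close>

definition decreases_to_0 :: "(nat \<Rightarrow> 'a::archimedean_riesz_space) \<Rightarrow> bool" where
  "decreases_to_0 w \<longleftrightarrow> decseq w \<and> isGlb UNIV (range w) 0"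

definition order_converges :: "(nat \<Rightarrow> 'a::archimedean_riesz_space) \<Rightarrow> 'a \<Rightarrow> bool" where
  "order_converges z l \<longleftrightarrow> (\<exists>w. decreases_to_0 w \<and> (\<forall>n. \<bar>z n - l\<bar> \<le> w n))"

definition order_uniformly_converges ::
    "'w set \<Rightarrow> (nat \<Rightarrow> 'w \<Rightarrow> 'a::archimedean_riesz_space) \<Rightarrow> ('w \<Rightarrow> 'a) \<Rightarrow> bool" where
  "order_uniformly_converges \<Omega> f g \<longleftrightarrow>
     (\<exists>u. decreases_to_0 u \<and> (\<forall>\<omega>\<in>\<Omega>. \<forall>n. \<bar>f n \<omega> - g \<omega>\<bar> \<le> u n))"

section \<open>Nets and net convergence structures\<close>

text \<open>A net is a pair of a directed preorder \<open>r\<close>, whose index set is \<open>Field r\<close>, and a function on the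
  indices; \<open>(i, j) \<in> r\<close> means \<open>i \<le> j\<close>. A convergence structure is a predicate \<open>\<eta> r x v\<close>, read
  ``the net \<open>x\<close> over \<open>r\<close> converges to \<open>v\<close>''. HOL has no quantification over types inside a formula,
  so the index sets of all nets of one structure are subsets of a type \<open>'i\<close>; this type is a free
  variable throughout, i.e. an arbitrary universe of indices.\<close>

definition directed :: "'i rel \<Rightarrow> bool" where
  "directed r \<longleftrightarrow> Preorder r \<and> Field r \<noteq> {} \<and>
     (\<forall>i\<in>Field r. \<forall>j\<in>Field r. \<exists>k. (i, k) \<in> r \<and> (j, k) \<in> r)"

definition quasi_subnet :: "'j rel \<Rightarrow> ('j \<Rightarrow> 'v) \<Rightarrow> 'i rel \<Rightarrow> ('i \<Rightarrow> 'v) \<Rightarrow> bool" where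
  "quasi_subnet s y r x \<longleftrightarrow>
     (\<forall>i0\<in>Field r. \<exists>j0\<in>Field s. y ` {j. (j0, j) \<in> s} \<subseteq> x ` {i. (i0, i) \<in> r})"

type_synonym ('i, 'v) net_conv = "'i rel \<Rightarrow> ('i \<Rightarrow> 'v) \<Rightarrow> 'v \<Rightarrow> bool"

locale net_convergence_structure =
  fixes \<eta> :: "('i, 'v) net_conv"
  assumes const: "directed r \<Longrightarrow> \<eta> r (\<lambda>_. v) v"
    and quasi_subnet:
      "directed r \<Longrightarrow> directed s \<Longrightarrow> \<eta> r x v \<Longrightarrow> quasi_subnet s y r x \<Longrightarrow> \<eta> s y v"
    and mix:
      "directed r \<Longrightarrow> \<eta> r x v \<Longrightarrow> \<eta> r y v \<Longrightarrow> (\<And>i. i \<in> Field r \<Longrightarrow> z i \<in> {x i, y i}) \<Longrightarrow> \<eta> r z v"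

locale riesz_convergence_structure = net_convergence_structure \<eta>
  for \<eta> :: "('i, 'v::archimedean_riesz_space) net_conv" +
  assumes Hausdorff: "directed r \<Longrightarrow> \<eta> r x v \<Longrightarrow> \<eta> r x w \<Longrightarrow> v = w"
    and add: "directed r \<Longrightarrow> \<eta> r x v \<Longrightarrow> \<eta> r y w \<Longrightarrow> \<eta> r (\<lambda>i. x i + y i) (v + w)"
    and scaleR: "directed r \<Longrightarrow> \<eta> r x v \<Longrightarrow> \<eta> r (\<lambda>i. c *\<^sub>R x i) (c *\<^sub>R v)"
    and locally_solid:
      "directed r \<Longrightarrow> directed s \<Longrightarrow> \<eta> s y 0 \<Longrightarrow>
       (\<And>l0. l0 \<in> Field s \<Longrightarrow>
          \<exists>i0\<in>Field r. \<forall>i. (i0, i) \<in> r \<longrightarrow> (\<exists>l. (l0, l) \<in> s \<and> \<bar>x i\<bar> \<le> \<bar>y l\<bar>)) \<Longrightarrow>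
       \<eta> r x 0"

section \<open>(D)-convergence\<close>

definition D_sequence :: "(nat \<Rightarrow> nat \<Rightarrow> 'a::archimedean_riesz_space) \<Rightarrow> bool" where
  "D_sequence a \<longleftrightarrow> (\<exists>b. \<forall>i j. a i j \<le> b) \<and> (\<forall>i. decreases_to_0 (a i))"

text \<open>The suprema below are over nonempty sets bounded above by definition of \<^const>\<open>D_sequence\<close>.\<close>

definition D_converges ::
    "('i, 'a::{archimedean_riesz_space, conditionally_complete_lattice}) net_conv" where
  "D_converges r x v \<longleftrightarrow>
     (\<exists>a. D_sequence a \<and>
       (\<forall>\<phi>::nat \<Rightarrow> nat. \<exists>i0\<in>Field r. \<forall>i. (i0, i) \<in> r \<longrightarrow> \<bar>x i - v\<bar> \<le> (SUP j. a j (\<phi> j))))"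

definition weakly_sigma_distributive ::
    "'a::{archimedean_riesz_space, conditionally_complete_lattice} itself \<Rightarrow> bool" where
  "weakly_sigma_distributive _ \<longleftrightarrow>
     (\<forall>a :: nat \<Rightarrow> nat \<Rightarrow> 'a. D_sequence a \<longrightarrow>
        isGlb UNIV (range (\<lambda>\<phi>::nat \<Rightarrow> nat. SUP i. a i (\<phi> i))) 0)"

section \<open>Integration structures\<close>

text \<open>For \<open>A \<in> \<H>\<close> the net attached to \<open>A\<close> is indexed by \<open>gam N A\<close>; the member with index \<open>\<gamma>\<close> is the pair
  of families \<open>cell N A \<gamma>\<close> (the sets \<open>\<sigma>\<^sub>i\<close>) and \<open>tag N A \<gamma>\<close> (the points \<open>\<tau>\<^sub>i\<close>) over \<open>idx N A \<gamma>\<close>.\<close>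

record ('w, 'i, 'k) tagged_nets =
  gam :: "'w set \<Rightarrow> 'i rel"
  idx :: "'w set \<Rightarrow> 'i \<Rightarrow> 'k set"
  cell :: "'w set \<Rightarrow> 'i \<Rightarrow> 'k \<Rightarrow> 'w set"
  tag :: "'w set \<Rightarrow> 'i \<Rightarrow> 'k \<Rightarrow> 'w"

locale po_integration_structure =
  sigma_algebra \<Omega> \<H> +
  X: riesz_convergence_structure \<eta>\<^sub>1 +
  Y: riesz_convergence_structure \<eta>\<^sub>2 +
  Z: riesz_convergence_structure \<eta>\<^sub>3
  for \<Omega> :: "'w set" and \<H> :: "'w set set"
    and N :: "('w, 'i, 'k) tagged_nets"
    and \<eta>\<^sub>1 :: "('i, 'x::archimedean_riesz_space) net_conv"
    and \<eta>\<^sub>2 :: "('i, 'y::archimedean_riesz_space) net_conv"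
    and \<eta>\<^sub>3 :: "('i, 'z::archimedean_riesz_space) net_conv"
    and p :: "'x \<Rightarrow> 'y \<Rightarrow> 'z" +
  assumes directed_gam: "A \<in> \<H> \<Longrightarrow> directed (gam N A)"
    and finite_idx: "A \<in> \<H> \<Longrightarrow> \<gamma> \<in> Field (gam N A) \<Longrightarrow> finite (idx N A \<gamma>)"
    and cell: "A \<in> \<H> \<Longrightarrow> \<gamma> \<in> Field (gam N A) \<Longrightarrow> i \<in> idx N A \<gamma> \<Longrightarrow> cell N A \<gamma> i \<in> \<H>"
    and tag: "A \<in> \<H> \<Longrightarrow> \<gamma> \<in> Field (gam N A) \<Longrightarrow> i \<in> idx N A \<gamma> \<Longrightarrow> tag N A \<gamma> i \<in> \<Omega>"
    and bilinear: "bilinear p"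
    and continuous_left: "directed r \<Longrightarrow> \<eta>\<^sub>1 r x v \<Longrightarrow> \<eta>\<^sub>3 r (\<lambda>i. p (x i) y) (p v y)"
    and continuous_right: "directed r \<Longrightarrow> \<eta>\<^sub>2 r y' w \<Longrightarrow> \<eta>\<^sub>3 r (\<lambda>i. p x' (y' i)) (p x' w)"
    and isotone: "0 \<le> a \<Longrightarrow> a \<le> a' \<Longrightarrow> 0 \<le> b \<Longrightarrow> b \<le> b' \<Longrightarrow> p a b \<le> p a' b'"
    and sup_left: "(\<And>n::nat. 0 \<le> xs n) \<Longrightarrow> isLub UNIV (range xs) a \<Longrightarrow> 0 \<le> b \<Longrightarrow>
      isLub UNIV (range (\<lambda>n. p (xs n) b)) (p a b)"
    and sup_right: "(\<And>n::nat. 0 \<le> ys n) \<Longrightarrow> isLub UNIV (range ys) b \<Longrightarrow> 0 \<le> a \<Longrightarrow>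
      isLub UNIV (range (\<lambda>n. p a (ys n))) (p a b)"

section \<open>The net Riemann integral\<close>

text \<open>The product \<open>p\<close> and the convergence \<open>\<eta>\<close> in its codomain are arguments, since the integral is also
  used for scalar multiplication \<open>\<real> \<times> Y \<rightarrow> Y\<close> and \<open>\<eta>\<^sub>2\<close>.\<close>

definition riemann_sum ::
    "('w, 'i, 'k) tagged_nets \<Rightarrow> ('x \<Rightarrow> 'y \<Rightarrow> 'z::comm_monoid_add) \<Rightarrow>
     'w set \<Rightarrow> ('w \<Rightarrow> 'x) \<Rightarrow> ('w set \<Rightarrow> 'y) \<Rightarrow> 'i \<Rightarrow> 'z" where
  "riemann_sum N p A f \<mu> \<gamma> = (\<Sum>i\<in>idx N A \<gamma>. p (f (tag N A \<gamma> i)) (\<mu> (cell N A \<gamma> i)))"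

definition has_net_integral ::
    "('w, 'i, 'k) tagged_nets \<Rightarrow> ('x \<Rightarrow> 'y \<Rightarrow> 'z::comm_monoid_add) \<Rightarrow> ('i, 'z) net_conv \<Rightarrow>
     'w set \<Rightarrow> ('w \<Rightarrow> 'x) \<Rightarrow> ('w set \<Rightarrow> 'y) \<Rightarrow> 'z \<Rightarrow> bool" where
  "has_net_integral N p \<eta> A f \<mu> z \<longleftrightarrow> \<eta> (gam N A) (riemann_sum N p A f \<mu>) z"

definition net_integrable ::
    "('w, 'i, 'k) tagged_nets \<Rightarrow> ('x \<Rightarrow> 'y \<Rightarrow> 'z::comm_monoid_add) \<Rightarrow> ('i, 'z) net_conv \<Rightarrow>
     'w set \<Rightarrow> ('w \<Rightarrow> 'x) \<Rightarrow> ('w set \<Rightarrow> 'y) \<Rightarrow> bool" where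
  "net_integrable N p \<eta> A f \<mu> \<longleftrightarrow> (\<exists>z. has_net_integral N p \<eta> A f \<mu> z)"

definition net_integral ::
    "('w, 'i, 'k) tagged_nets \<Rightarrow> ('x \<Rightarrow> 'y \<Rightarrow> 'z::comm_monoid_add) \<Rightarrow> ('i, 'z) net_conv \<Rightarrow>
     'w set \<Rightarrow> ('w \<Rightarrow> 'x) \<Rightarrow> ('w set \<Rightarrow> 'y) \<Rightarrow> 'z" where
  "net_integral N p \<eta> A f \<mu> = (THE z. has_net_integral N p \<eta> A f \<mu> z)"

definition regular_integrator ::
    "'w set \<Rightarrow> 'w set set \<Rightarrow> ('w, 'i, 'k) tagged_nets \<Rightarrow> ('i, 'y::real_vector) net_conv \<Rightarrow>
     ('w set \<Rightarrow> 'y) \<Rightarrow> bool" where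
  "regular_integrator \<Omega> \<H> N \<eta> \<mu> \<longleftrightarrow>
     (\<forall>A\<in>\<H>. has_net_integral N (*\<^sub>R) \<eta> A (indicator \<Omega>) \<mu> (\<mu> A) \<and>
            has_net_integral N (*\<^sub>R) \<eta> \<Omega> (indicator A) \<mu> (\<mu> A))"

text \<open>The standing convention on the nets: summing a finitely additive \<open>\<mu>\<close> over the cells of any member
  of a net gives the value of \<open>\<mu>\<close> on their union.\<close>

definition nets_sum_additive ::
    "'w set set \<Rightarrow> ('w, 'i, 'k) tagged_nets \<Rightarrow> ('w set \<Rightarrow> 'y::comm_monoid_add) \<Rightarrow> bool" where
  "nets_sum_additive \<H> N \<mu> \<longleftrightarrow>
     (Measure_Space.additive \<H> \<mu> \<longrightarrow>
       (\<forall>A\<in>\<H>. \<forall>\<gamma>\<in>Field (gam N A).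
          (\<Sum>i\<in>idx N A \<gamma>. \<mu> (cell N A \<gamma> i)) = \<mu> (\<Union>i\<in>idx N A \<gamma>. cell N A \<gamma> i)))"

end

theory Submission
  imports Defs
begin

text \<open>
  The proof compares Riemann sums. Regularity makes \<open>\<mu>\<close> finitely additive, because
  \<open>\<mu> A\<close> is the integral of the indicator of \<open>A\<close> and limits are additive and unique. Hence the masses
  of the cells of a member of the net over \<open>\<Omega>\<close> add up to at most \<open>\<mu> \<Omega>\<close>. If \<open>\<bar>f n - g\<bar> \<le> u n\<close>
  on \<open>\<Omega>\<close>, the Riemann sums of \<open>f n\<close> and \<open>g\<close> therefore differ by at most \<open>w n = u n \<bullet> \<mu> \<Omega>\<close>, uniformly
  along the net (lemma \<open>riemann_sum_diff_le\<close>), and \<open>w\<close> decreases to 0 because the product preserves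
  suprema of sequences.

  What remains is an exchange of limits for nets in \<open>Z\<close> (lemma \<open>uniform_limit_D_converges\<close>).
  Write \<open>l n\<close> for the integral of \<open>f n\<close>. Weak distributivity lets one drop the (D)-regulators from
  \<open>\<bar>l n - l m\<bar> \<le> w n + w m + regulators\<close>, so every \<open>l n - w n\<close> lies below every \<open>l m + w m\<close>.
  By Dedekind completeness \<open>v = (SUP n. l n - w n)\<close> exists, and it satisfies \<open>\<bar>l n - v\<bar> \<le> w n\<close>;
  this is the order convergence. For the Riemann sums of \<open>g\<close> to (D)-converge to \<open>v\<close>, the countably many
  regulators of the \<open>f n\<close> have to be replaced by a single one. Given \<open>\<phi>\<close>, the
  approximation by \<open>f n\<close> is needed for one value of \<open>n\<close> only, and \<open>n\<close> may depend on \<open>\<phi>\<close>. So it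
  suffices to let row 0 of the new regulator be a multiple of \<open>w\<close>, let its other rows run through the
  rows of all the given regulators, cut off at a common bound, and take \<open>n = \<phi> 0\<close>.
\<close>

section \<open>Sequences that decrease to zero\<close>

lemma isGlb_UNIV_range_iff:
  fixes w :: "'b \<Rightarrow> 'a::order"
  shows "isGlb UNIV (range w) v \<longleftrightarrow> (\<forall>n. v \<le> w n) \<and> (\<forall>b. (\<forall>n. b \<le> w n) \<longrightarrow> b \<le> v)"
  unfolding isGlb_def greatestP_def isLb_def setge_def setle_def by auto

lemma isLub_UNIV_range_iff:
  fixes w :: "'b \<Rightarrow> 'a::order"
  shows "isLub UNIV (range w) v \<longleftrightarrow> (\<forall>n. w n \<le> v) \<and> (\<forall>b. (\<forall>n. w n \<le> b) \<longrightarrow> v \<le> b)"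
  unfolding isLub_def leastP_def isUb_def setge_def setle_def by auto

lemma decreases_to_0_iff:
  "decreases_to_0 w \<longleftrightarrow> decseq w \<and> (\<forall>n. 0 \<le> w n) \<and> (\<forall>b. (\<forall>n. b \<le> w n) \<longrightarrow> b \<le> 0)"
  by (simp add: decreases_to_0_def isGlb_UNIV_range_iff)

lemma decreases_to_0_nonneg: "decreases_to_0 w \<Longrightarrow> 0 \<le> w n"
  by (simp add: decreases_to_0_iff)

lemma decreases_to_0_antimono: "decreases_to_0 w \<Longrightarrow> m \<le> n \<Longrightarrow> w n \<le> w m"
  by (simp add: decreases_to_0_iff decseq_def)

lemma decreases_to_0_scaleR:
  assumes "decreases_to_0 w" "0 < c"
  shows "decreases_to_0 (\<lambda>n. c *\<^sub>R w n)"
  unfolding decreases_to_0_iff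
proof (intro conjI allI impI)
  show "decseq (\<lambda>n. c *\<^sub>R w n)"
    using decreases_to_0_antimono[OF assms(1)] assms(2)
    by (auto simp: decseq_def intro!: scaleR_left_mono)
  show "0 \<le> c *\<^sub>R w n" for n
    using assms by (simp add: decreases_to_0_nonneg scaleR_nonneg_nonneg)
  fix b assume b: "\<forall>n. b \<le> c *\<^sub>R w n"
  have "inverse c *\<^sub>R b \<le> w n" for n
    using scaleR_left_mono[OF b[rule_format, of n], of "inverse c"] assms(2) by simp
  then have "inverse c *\<^sub>R b \<le> 0"
    using assms(1) by (simp add: decreases_to_0_iff)
  from scaleR_left_mono[OF this, of c] show "b \<le> 0"
    using assms(2) by simp
qed

lemma decreases_to_0_inf:
  assumes "decreases_to_0 w" "0 \<le> e"
  shows "decreases_to_0 (\<lambda>n. inf e (w n))"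
  unfolding decreases_to_0_iff
proof (intro conjI allI impI)
  show "decseq (\<lambda>n. inf e (w n))"
    using assms by (auto simp: decseq_def intro: le_infI2 decreases_to_0_antimono)
  show "0 \<le> inf e (w n)" for n
    using assms by (simp add: decreases_to_0_nonneg)
  show "b \<le> 0" if "\<forall>n. b \<le> inf e (w n)" for b
    using that assms(1) by (simp add: decreases_to_0_iff)
qed

section \<open>Uniform approximation of (D)-convergent nets\<close>

lemma D_sequence_bdd_above:
  fixes a :: "nat \<Rightarrow> nat \<Rightarrow> 'a::{archimedean_riesz_space, conditionally_complete_lattice}"
  assumes "D_sequence a"
  shows "bdd_above (range (\<lambda>j. a j (\<phi> j)))"
  using assms by (auto simp: D_sequence_def bdd_above_def)

lemma D_sequence_SUP_nonneg:
  fixes a :: "nat \<Rightarrow> nat \<Rightarrow> 'a::{archimedean_riesz_space, conditionally_complete_lattice}"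
  assumes "D_sequence a"
  shows "0 \<le> (SUP j. a j (\<phi> j))"
proof (rule cSUP_upper2[OF D_sequence_bdd_above[OF assms] UNIV_I])
  show "0 \<le> a 0 (\<phi> 0)"
    using assms by (auto simp: D_sequence_def decreases_to_0_nonneg)
qed

lemma weakly_sigma_distributiveD:
  fixes b e :: "'a::{archimedean_riesz_space, conditionally_complete_lattice}"
  assumes "weakly_sigma_distributive TYPE('a)" "D_sequence a"
    and le: "\<And>\<phi>. b \<le> e + (SUP j. a j (\<phi> j))"
  shows "b \<le> e"
proof -
  have "isGlb UNIV (range (\<lambda>\<phi>. SUP j. a j (\<phi> j))) 0"
    using assms unfolding weakly_sigma_distributive_def by blast
  moreover have "b - e \<le> (SUP j. a j (\<phi> j))" for \<phi>
    using le[of \<phi>] by (simp add: diff_le_eq add.commute)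
  ultimately have "b - e \<le> 0"
    unfolding isGlb_UNIV_range_iff by blast
  then show ?thesis by simp
qed

lemma abs_diff_triangle3:
  fixes a b c d :: "'a::archimedean_riesz_space"
  assumes "\<bar>a - b\<bar> \<le> r" "\<bar>b - c\<bar> \<le> s" "\<bar>c - d\<bar> \<le> t"
  shows "\<bar>a - d\<bar> \<le> r + s + t"
proof -
  have "\<bar>a - d\<bar> = \<bar>(a - b) + (b - c) + (c - d)\<bar>" by simp
  also have "\<dots> \<le> \<bar>a - b\<bar> + \<bar>b - c\<bar> + \<bar>c - d\<bar>"
    by (meson abs_triangle_ineq add_right_mono order_trans)
  also have "\<dots> \<le> r + s + t"
    using assms by (intro add_mono)
  finally show ?thesis .
qed

text \<open>The regulators of the two nets are removed one after the other: the infimum over the selection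
  \<open>\<phi>\<close> for \<open>x\<close> is taken while the selection \<open>\<psi>\<close> for \<open>y\<close> is held fixed.\<close>

lemma D_limits_diff_le:
  fixes v w :: "'a::{archimedean_riesz_space, conditionally_complete_lattice}"
  assumes wsd: "weakly_sigma_distributive TYPE('a)" and r: "directed r"
    and x: "D_converges r x v" and y: "D_converges r y w"
    and near: "\<And>i. i \<in> Field r \<Longrightarrow> \<bar>x i - y i\<bar> \<le> e"
  shows "\<bar>v - w\<bar> \<le> e"
proof -
  obtain a where a: "D_sequence a"
    "\<And>\<phi>. \<exists>i0\<in>Field r. \<forall>i. (i0, i) \<in> r \<longrightarrow> \<bar>x i - v\<bar> \<le> (SUP j. a j (\<phi> j))"
    using x unfolding D_converges_def by blast
  obtain b where b: "D_sequence b"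
    "\<And>\<phi>. \<exists>i0\<in>Field r. \<forall>i. (i0, i) \<in> r \<longrightarrow> \<bar>y i - w\<bar> \<le> (SUP j. b j (\<phi> j))"
    using y unfolding D_converges_def by blast
  have le: "\<bar>v - w\<bar> \<le> e + (SUP j. b j (\<psi> j)) + (SUP j. a j (\<phi> j))" for \<phi> \<psi>
  proof -
    obtain i1 i2 where i: "i1 \<in> Field r" "i2 \<in> Field r"
      "\<And>i. (i1, i) \<in> r \<Longrightarrow> \<bar>x i - v\<bar> \<le> (SUP j. a j (\<phi> j))"
      "\<And>i. (i2, i) \<in> r \<Longrightarrow> \<bar>y i - w\<bar> \<le> (SUP j. b j (\<psi> j))"
      using a(2)[of \<phi>] b(2)[of \<psi>] by blast
    obtain k where k: "(i1, k) \<in> r" "(i2, k) \<in> r"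
      using r i(1,2) unfolding directed_def by blast
    then have "k \<in> Field r" by (auto simp: Field_def)
    then have "\<bar>v - w\<bar> \<le> (SUP j. a j (\<phi> j)) + e + (SUP j. b j (\<psi> j))"
      using i(3)[OF k(1)] i(4)[OF k(2)] near[of k]
      by (intro abs_diff_triangle3[of v "x k" _ "y k"]) (simp_all add: abs_minus_commute)
    then show ?thesis by (simp add: ac_simps)
  qed
  have "\<bar>v - w\<bar> \<le> e + (SUP j. b j (\<psi> j))" for \<psi>
    using weakly_sigma_distributiveD[OF wsd a(1)] le by blast
  then show ?thesis
    using weakly_sigma_distributiveD[OF wsd b(1)] by blast
qed

text \<open>The intervals \<open>[l n - w n, l n + w n]\<close> meet pairwise, and in a Dedekind complete Riesz space
  the supremum of their left ends then lies in all of them.\<close>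

lemma common_centre_exists:
  fixes l w :: "nat \<Rightarrow> 'a::{archimedean_riesz_space, conditionally_complete_lattice}"
  assumes near: "\<And>m n. \<bar>l m - l n\<bar> \<le> w m + w n"
  obtains v where "\<And>n. \<bar>l n - v\<bar> \<le> w n"
proof
  have le: "l m - w m \<le> l n + w n" for m n
  proof -
    have "l m - l n \<le> w m + w n"
      using near[of m n] abs_ge_self order_trans by blast
    then show ?thesis by (simp add: algebra_simps)
  qed
  have bdd: "bdd_above (range (\<lambda>n. l n - w n))"
    using le by (auto simp: bdd_above_def)
  fix n
  have "l n - w n \<le> (SUP n. l n - w n)"
    by (intro cSUP_upper bdd) simp
  moreover have "(SUP n. l n - w n) \<le> l n + w n"
    by (intro cSUP_least le) simp
  ultimately show "\<bar>l n - (SUP n. l n - w n)\<bar> \<le> w n"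
    by (intro abs_leI) (simp_all add: algebra_simps)
qed

text \<open>The infinite distributive law, in the half that is not immediate. It comes from
  \<open>a i + e = inf e (a i) + sup e (a i)\<close>, where both terms on the right can be bounded
  independently of \<open>i\<close>.\<close>

lemma inf_SUP_le_SUP_inf:
  fixes a :: "'b \<Rightarrow> 'a::{archimedean_riesz_space, conditionally_complete_lattice}"
  assumes bdd: "bdd_above (range a)"
  shows "inf e (SUP i. a i) \<le> (SUP i. inf e (a i))"
proof -
  let ?A = "SUP i. a i" and ?s = "SUP i. inf e (a i)"
  have bdd': "bdd_above (range (\<lambda>i. inf e (a i)))"
    by (auto simp: bdd_above_def intro: exI[of _ e])
  have "a i \<le> ?s + sup e ?A - e" for i
  proof -
    have "e + a i = sup e (a i) + inf e (a i)"
      by (rule add_eq_inf_sup)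
    also have "\<dots> \<le> sup e ?A + ?s"
      by (intro add_mono sup_mono cSUP_upper bdd bdd' order_refl UNIV_I)
    finally show ?thesis by (simp add: algebra_simps)
  qed
  then have "?A \<le> ?s + sup e ?A - e"
    by (intro cSUP_least) simp_all
  moreover have "e + ?A = sup e ?A + inf e ?A"
    by (rule add_eq_inf_sup)
  ultimately show ?thesis by (simp add: algebra_simps)
qed

text \<open>The single regulator for the limit net. Row 0 controls the index \<open>n = \<phi> 0\<close> of the approximating
  net, and the rows from 1 on enumerate the rows of all the regulators \<open>a n\<close>; the cut-off at \<open>e\<close> is what
  keeps this countable family bounded. The factor 2 turns a bound by the sum of one entry of row 0 and
  one supremum over the later rows into a bound by a single supremum.\<close>

definition merged_regulator ::
  "'a::archimedean_riesz_space \<Rightarrow> (nat \<Rightarrow> 'a) \<Rightarrow> (nat \<Rightarrow> nat \<Rightarrow> nat \<Rightarrow> 'a) \<Rightarrow> nat \<Rightarrow> nat \<Rightarrow> 'a" where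
  "merged_regulator e w a k j =
     (case k of 0 \<Rightarrow> 2 *\<^sub>R w j
      | Suc q \<Rightarrow> (case prod_decode q of (n, i) \<Rightarrow> 2 *\<^sub>R inf e (a n i j)))"

lemma D_sequence_merged_regulator:
  assumes w: "decreases_to_0 w" and a: "\<And>n. D_sequence (a n)" and e: "0 \<le> e"
  shows "D_sequence (merged_regulator e w a)"
  unfolding D_sequence_def
proof (intro conjI exI allI)
  show "merged_regulator e w a k j \<le> sup (2 *\<^sub>R w 0) (2 *\<^sub>R e)" for k j
  proof (cases k)
    case 0
    then show ?thesis
      using decreases_to_0_antimono[OF w, of 0 j]
      by (auto simp: merged_regulator_def intro!: le_supI1 scaleR_left_mono)
  next
    case (Suc q)
    then show ?thesis
      by (auto simp: merged_regulator_def split: prod.split intro!: le_supI2 scaleR_left_mono)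
  qed
  show "decreases_to_0 (merged_regulator e w a k)" for k
  proof (cases k)
    case 0
    then show ?thesis
      using decreases_to_0_scaleR[OF w, of 2] by (simp add: merged_regulator_def[abs_def])
  next
    case (Suc q)
    obtain n i where "prod_decode q = (n, i)" by (cases "prod_decode q")
    moreover have "decreases_to_0 (a n i)"
      using a by (simp add: D_sequence_def)
    ultimately show ?thesis
      using Suc decreases_to_0_scaleR[OF decreases_to_0_inf[OF _ e], of "a n i" 2]
      by (simp add: merged_regulator_def[abs_def])
  qed
qed

text \<open>For the index \<open>\<phi> 0\<close>, the selection that \<open>\<phi>\<close> makes in the merged regulator contains a selection
  from the rows of \<open>a (\<phi> 0)\<close>. The cut-off loses nothing for a \<open>t\<close> that is itself below \<open>e\<close>,
  by the distributive law above.\<close>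

lemma merged_regulator_bound:
  fixes t :: "'a::{archimedean_riesz_space, conditionally_complete_lattice}"
  assumes w: "decreases_to_0 w" and a: "\<And>n. D_sequence (a n)" and e: "0 \<le> e"
    and te: "t \<le> e"
    and t: "t \<le> w (\<phi> 0) + (SUP i. a (\<phi> 0) i (\<phi> (Suc (prod_encode (\<phi> 0, i)))))"
  shows "t \<le> (SUP k. merged_regulator e w a k (\<phi> k))"
proof -
  define n where "n = \<phi> 0"
  define \<psi> where "\<psi> i = \<phi> (Suc (prod_encode (n, i)))" for i
  define S where "S = (SUP k. merged_regulator e w a k (\<phi> k))"
  have upper: "merged_regulator e w a k (\<phi> k) \<le> S" for k
    unfolding S_def
    by (intro cSUP_upper UNIV_I D_sequence_bdd_above D_sequence_merged_regulator w a e)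
  have half: "x \<le> (1/2) *\<^sub>R S" if "2 *\<^sub>R x \<le> S" for x
    using scaleR_left_mono[OF that, of "1/2"] by simp
  have "w n \<le> (1/2) *\<^sub>R S"
    using upper[of 0] by (intro half) (simp add: merged_regulator_def n_def)
  moreover have "inf e (a n i (\<psi> i)) \<le> (1/2) *\<^sub>R S" for i
    using upper[of "Suc (prod_encode (n, i))"]
    by (intro half) (simp add: merged_regulator_def \<psi>_def)
  then have "(SUP i. inf e (a n i (\<psi> i))) \<le> (1/2) *\<^sub>R S"
    by (intro cSUP_least) simp_all
  moreover have "t - w n \<le> (SUP i. inf e (a n i (\<psi> i)))"
  proof (rule order_trans[OF _ inf_SUP_le_SUP_inf[OF D_sequence_bdd_above[OF a]]])
    have "t \<le> e + w n"
      using add_mono[OF te decreases_to_0_nonneg[OF w, of n]] by simp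
    then show "t - w n \<le> inf e (SUP i. a n i (\<psi> i))"
      using t by (simp add: n_def \<psi>_def diff_le_eq add.commute)
  qed
  ultimately have "w n + (t - w n) \<le> (1/2) *\<^sub>R S + (1/2) *\<^sub>R S"
    by (meson add_mono order_trans)
  also have "\<dots> = S"
    by (simp add: scaleR_left_distrib[symmetric])
  finally show ?thesis by (simp add: S_def)
qed

text \<open>The approximations are compared with \<open>y\<close> and their limits with \<open>v\<close>, so the error \<open>w n\<close> enters
  twice, and the merged regulator is formed with \<open>2 *\<^sub>R w\<close>. The approximation of index 0 supplies the
  cut-off.\<close>

lemma D_converges_if_approximated:
  fixes v :: "'a::{archimedean_riesz_space, conditionally_complete_lattice}"
  assumes r: "directed r" and x: "\<And>n. D_converges r (x n) (l n)" and w: "decreases_to_0 w"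
    and near: "\<And>n i. i \<in> Field r \<Longrightarrow> \<bar>x n i - y i\<bar> \<le> w n"
    and lim: "\<And>n. \<bar>l n - v\<bar> \<le> w n"
  shows "D_converges r y v"
proof -
  obtain a where a: "\<And>n. D_sequence (a n)"
    "\<And>n \<phi>. \<exists>i0\<in>Field r. \<forall>i. (i0, i) \<in> r \<longrightarrow> \<bar>x n i - l n\<bar> \<le> (SUP j. a n j (\<phi> j))"
    using x unfolding D_converges_def by metis
  have ev: "\<exists>i0\<in>Field r. \<forall>i. (i0, i) \<in> r \<longrightarrow> \<bar>y i - v\<bar> \<le> 2 *\<^sub>R w n + (SUP j. a n j (\<phi> j))"
    for n \<phi>
  proof -
    obtain i0 where i0: "i0 \<in> Field r"
      "\<And>i. (i0, i) \<in> r \<Longrightarrow> \<bar>x n i - l n\<bar> \<le> (SUP j. a n j (\<phi> j))"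
      using a(2) by blast
    have "\<bar>y i - v\<bar> \<le> 2 *\<^sub>R w n + (SUP j. a n j (\<phi> j))" if i: "(i0, i) \<in> r" for i
    proof -
      have "i \<in> Field r" using i by (auto simp: Field_def)
      then have "\<bar>y i - v\<bar> \<le> w n + (SUP j. a n j (\<phi> j)) + w n"
        using i0(2)[OF i] near[of i n] lim[of n]
        by (intro abs_diff_triangle3[of _ "x n i" _ "l n"]) (simp_all add: abs_minus_commute)
      then show ?thesis by (simp add: scaleR_2 ac_simps)
    qed
    with i0(1) show ?thesis by blast
  qed
  define e where "e = 2 *\<^sub>R w 0 + (SUP j. a 0 j 0)"
  have w2: "decreases_to_0 (\<lambda>n. 2 *\<^sub>R w n)"
    by (simp add: decreases_to_0_scaleR w)
  have e: "0 \<le> e"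
    unfolding e_def
    by (intro add_nonneg_nonneg decreases_to_0_nonneg[OF w2] D_sequence_SUP_nonneg a)
  let ?c = "merged_regulator e (\<lambda>n. 2 *\<^sub>R w n) a"
  have "\<exists>i0\<in>Field r. \<forall>i. (i0, i) \<in> r \<longrightarrow> \<bar>y i - v\<bar> \<le> (SUP k. ?c k (\<phi> k))" for \<phi>
  proof -
    let ?\<psi> = "\<lambda>i. \<phi> (Suc (prod_encode (\<phi> 0, i)))"
    obtain i1 where i1: "i1 \<in> Field r" "\<And>i. (i1, i) \<in> r \<Longrightarrow> \<bar>y i - v\<bar> \<le> e"
      using ev[of 0 "\<lambda>_. 0"] unfolding e_def by blast
    obtain i2 where i2: "i2 \<in> Field r" "\<And>i. (i2, i) \<in> r \<Longrightarrow>
        \<bar>y i - v\<bar> \<le> 2 *\<^sub>R w (\<phi> 0) + (SUP j. a (\<phi> 0) j (?\<psi> j))"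
      using ev[of "\<phi> 0" ?\<psi>] by blast
    obtain k where k: "(i1, k) \<in> r" "(i2, k) \<in> r"
      using r i1(1) i2(1) unfolding directed_def by blast
    have "trans r"
      using r by (auto simp: directed_def order_on_defs)
    then have "\<bar>y i - v\<bar> \<le> (SUP k. ?c k (\<phi> k))" if "(k, i) \<in> r" for i
      using that k by (intro merged_regulator_bound[OF w2 a(1) e] i1 i2) (auto dest: transD)
    moreover have "k \<in> Field r" using k by (auto simp: Field_def)
    ultimately show ?thesis by blast
  qed
  moreover have "D_sequence ?c"
    by (intro D_sequence_merged_regulator w2 a e)
  ultimately show ?thesis
    unfolding D_converges_def by blast
qed

lemma uniform_limit_D_converges:
  fixes l :: "nat \<Rightarrow> 'a::{archimedean_riesz_space, conditionally_complete_lattice}"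
  assumes wsd: "weakly_sigma_distributive TYPE('a)" and r: "directed r"
    and x: "\<And>n. D_converges r (x n) (l n)" and w: "decreases_to_0 w"
    and near: "\<And>n i. i \<in> Field r \<Longrightarrow> \<bar>x n i - y i\<bar> \<le> w n"
  obtains v where "D_converges r y v" "order_converges l v"
proof -
  have "\<bar>l m - l n\<bar> \<le> w m + w n" for m n
  proof (rule D_limits_diff_le[OF wsd r x x])
    fix i assume "i \<in> Field r"
    then have "\<bar>x m i - x n i\<bar> \<le> w m + w n + 0"
      using near[of i m] near[of i n]
      by (intro abs_diff_triangle3[of _ "y i" _ "x n i"]) (simp_all add: abs_minus_commute)
    then show "\<bar>x m i - x n i\<bar> \<le> w m + w n" by simp
  qed
  then obtain v where v: "\<And>n. \<bar>l n - v\<bar> \<le> w n"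
    using common_centre_exists[of l w] by blast
  show thesis
  proof
    show "D_converges r y v"
      by (rule D_converges_if_approximated[OF r x w near v])
    show "order_converges l v"
      unfolding order_converges_def using w v by blast
  qed
qed

section \<open>Riemann sums\<close>

text \<open>Both sides are limits of the same net, since the Riemann sums of the indicator of a disjoint union
  split.\<close>

lemma (in po_integration_structure) regular_integrator_additive:
  assumes "regular_integrator \<Omega> \<H> N \<eta>\<^sub>2 \<mu>"
  shows "Measure_Space.additive \<H> \<mu>"
  unfolding Measure_Space.additive_def
proof (intro ballI impI)
  fix A B assume AB: "A \<in> \<H>" "B \<in> \<H>" "A \<inter> B = {}"
  have lim: "\<eta>\<^sub>2 (gam N \<Omega>) (riemann_sum N (*\<^sub>R) \<Omega> (indicator C) \<mu>) (\<mu> C)" if "C \<in> \<H>" for C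
    using assms that unfolding regular_integrator_def has_net_integral_def by blast
  have r: "directed (gam N \<Omega>)"
    by (simp add: directed_gam)
  have "riemann_sum N (*\<^sub>R) \<Omega> (indicator (A \<union> B)) \<mu> =
      (\<lambda>\<gamma>. riemann_sum N (*\<^sub>R) \<Omega> (indicator A) \<mu> \<gamma> + riemann_sum N (*\<^sub>R) \<Omega> (indicator B) \<mu> \<gamma>)"
    using AB(3)
    by (simp add: riemann_sum_def fun_eq_iff indicator_add[symmetric] scaleR_left_distrib
        sum.distrib)
  then show "\<mu> (A \<union> B) = \<mu> A + \<mu> B"
    using Y.Hausdorff[OF r lim[of "A \<union> B"]] Y.add[OF r lim[OF AB(1)] lim[OF AB(2)]] AB
    by auto
qed

lemma (in po_integration_structure) sum_cells_le:
  fixes \<mu> :: "'w set \<Rightarrow> 'c::archimedean_riesz_space"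
  assumes pos: "\<forall>A\<in>\<H>. 0 \<le> \<mu> A" and "nets_sum_additive \<H> N \<mu>"
    and "Measure_Space.additive \<H> \<mu>" and A: "A \<in> \<H>" and \<gamma>: "\<gamma> \<in> Field (gam N A)"
  shows "(\<Sum>i\<in>idx N A \<gamma>. \<mu> (cell N A \<gamma> i)) \<le> \<mu> \<Omega>"
proof -
  let ?U = "\<Union>i\<in>idx N A \<gamma>. cell N A \<gamma> i"
  have U: "?U \<in> \<H>"
    using finite_idx[OF A \<gamma>] cell[OF A \<gamma>] by auto
  have "\<mu> (?U \<union> (\<Omega> - ?U)) = \<mu> ?U + \<mu> (\<Omega> - ?U)"
    using assms(3) U unfolding Measure_Space.additive_def by blast
  moreover have "?U \<union> (\<Omega> - ?U) = \<Omega>"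
    using sets_into_space[OF U] by blast
  moreover have "0 \<le> \<mu> (\<Omega> - ?U)"
    using pos U by blast
  ultimately have "\<mu> ?U \<le> \<mu> \<Omega>"
    by (simp only: le_add_same_cancel1)
  then show ?thesis
    using assms(2,3) A \<gamma> unfolding nets_sum_additive_def by simp
qed

lemma (in po_integration_structure) product_nonneg: "0 \<le> a \<Longrightarrow> 0 \<le> b \<Longrightarrow> 0 \<le> p a b"
  using isotone[of 0 a 0 b] bilinear_lzero[OF bilinear] by simp

lemma (in po_integration_structure) abs_product_le:
  assumes "\<bar>x\<bar> \<le> a" "0 \<le> b"
  shows "\<bar>p x b\<bar> \<le> p a b"
proof (rule abs_leI)
  have "x \<le> a" "- x \<le> a"
    using assms(1) abs_ge_self[of x] abs_ge_minus_self[of x] by (blast intro: order_trans)+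
  then have "0 \<le> a - x" "0 \<le> a - (- x)"
    by (simp_all only: diff_ge_0_iff_ge)
  from this[THEN product_nonneg, OF assms(2)]
  have "0 \<le> p a b - p x b" "0 \<le> p a b - (- p x b)"
    by (simp_all only: bilinear_lsub[OF bilinear] bilinear_lneg[OF bilinear])
  then show "p x b \<le> p a b" "- p x b \<le> p a b"
    by (simp_all only: diff_ge_0_iff_ge)
qed

lemma (in po_integration_structure) riemann_sum_diff_le:
  assumes pos: "\<forall>A\<in>\<H>. 0 \<le> \<mu> A" and "nets_sum_additive \<H> N \<mu>"
    and "Measure_Space.additive \<H> \<mu>" and A: "A \<in> \<H>" and \<gamma>: "\<gamma> \<in> Field (gam N A)"
    and near: "\<And>\<omega>. \<omega> \<in> \<Omega> \<Longrightarrow> \<bar>h \<omega> - g \<omega>\<bar> \<le> u" and u: "0 \<le> u"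
  shows "\<bar>riemann_sum N p A h \<mu> \<gamma> - riemann_sum N p A g \<mu> \<gamma>\<bar> \<le> p u (\<mu> \<Omega>)"
proof -
  let ?I = "idx N A \<gamma>" and ?m = "\<lambda>i. \<mu> (cell N A \<gamma> i)" and ?t = "\<lambda>i. tag N A \<gamma> i"
  have m: "0 \<le> ?m i" if "i \<in> ?I" for i
    using pos cell[OF A \<gamma> that] by blast
  have "\<bar>riemann_sum N p A h \<mu> \<gamma> - riemann_sum N p A g \<mu> \<gamma>\<bar>
      = \<bar>\<Sum>i\<in>?I. p (h (?t i) - g (?t i)) (?m i)\<bar>"
    by (simp add: riemann_sum_def sum_subtractf bilinear_lsub[OF bilinear])
  also have "\<dots> \<le> (\<Sum>i\<in>?I. \<bar>p (h (?t i) - g (?t i)) (?m i)\<bar>)"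
    by (rule sum_abs)
  also have "\<dots> \<le> (\<Sum>i\<in>?I. p u (?m i))"
    by (intro sum_mono abs_product_le near m tag[OF A \<gamma>])
  also have "\<dots> = p u (\<Sum>i\<in>?I. ?m i)"
    using bilinear by (simp add: bilinear_def linear_sum)
  also have "\<dots> \<le> p u (\<mu> \<Omega>)"
    using m by (intro isotone u order_refl sum_nonneg sum_cells_le assms)
  finally show ?thesis .
qed

text \<open>The structure only provides suprema, so the decreasing sequence \<open>u\<close> is reflected to the
  nonnegative sequence \<open>u 0 - u n\<close>, whose supremum is \<open>u 0\<close>.\<close>

lemma (in po_integration_structure) decreases_to_0_product:
  assumes u: "decreases_to_0 u" and b: "0 \<le> b"
  shows "decreases_to_0 (\<lambda>n. p (u n) b)"
  unfolding decreases_to_0_iff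
proof (intro conjI allI impI)
  show "decseq (\<lambda>n. p (u n) b)"
    unfolding decseq_def
    by (auto intro!: isotone decreases_to_0_nonneg[OF u] decreases_to_0_antimono[OF u] b)
  show "0 \<le> p (u n) b" for n
    by (intro product_nonneg decreases_to_0_nonneg[OF u] b)
  have "isLub UNIV (range (\<lambda>n. u 0 - u n)) (u 0)"
    unfolding isLub_UNIV_range_iff
  proof (intro conjI allI impI)
    show "u 0 - u n \<le> u 0" for n
      using decreases_to_0_nonneg[OF u] by simp
    fix c assume "\<forall>n. u 0 - u n \<le> c"
    then have "\<forall>n. u 0 - c \<le> u n"
      by (simp add: algebra_simps)
    then have "u 0 - c \<le> 0"
      using u unfolding decreases_to_0_iff by blast
    then show "u 0 \<le> c" by simp
  qed
  then have "isLub UNIV (range (\<lambda>n. p (u 0 - u n) b)) (p (u 0) b)"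
    using decreases_to_0_antimono[OF u] by (intro sup_left b) simp_all
  then have sup: "p (u 0) b \<le> d" if "\<And>n. p (u 0) b - p (u n) b \<le> d" for d
    using that by (simp add: isLub_UNIV_range_iff bilinear_lsub[OF bilinear])
  fix c assume "\<forall>n. c \<le> p (u n) b"
  then have "p (u 0) b \<le> p (u 0) b - c"
    by (intro sup) simp
  then show "c \<le> 0" by simp
qed

lemma (in po_integration_structure) net_integral_eq:
  assumes "A \<in> \<H>" "has_net_integral N p \<eta>\<^sub>3 A h \<mu> z"
  shows "net_integral N p \<eta>\<^sub>3 A h \<mu> = z"
  unfolding net_integral_def
  using assms Z.Hausdorff[OF directed_gam] unfolding has_net_integral_def by blast

section \<open>Order uniform limits under the integral\<close>

theorem theorem4p1:
  fixes \<Omega> :: "'w set" and \<H> :: "'w set set"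
    and N :: "('w, 'i, 'k) tagged_nets"
    and \<eta>\<^sub>1 :: "('i, 'x::archimedean_riesz_space) net_conv"
    and \<eta>\<^sub>2 :: "('i, 'y::archimedean_riesz_space) net_conv"
    and p :: "'x \<Rightarrow> 'y \<Rightarrow> 'z::{archimedean_riesz_space, conditionally_complete_lattice}"
    and \<mu> :: "'w set \<Rightarrow> 'y"
    and f :: "nat \<Rightarrow> 'w \<Rightarrow> 'x" and g :: "'w \<Rightarrow> 'x"
  assumes "po_integration_structure \<Omega> \<H> N \<eta>\<^sub>1 \<eta>\<^sub>2 D_converges p"
    and "weakly_sigma_distributive TYPE('z)"
    and "\<forall>A\<in>\<H>. 0 \<le> \<mu> A"
    and "nets_sum_additive \<H> N \<mu>"
    and "regular_integrator \<Omega> \<H> N \<eta>\<^sub>2 \<mu>"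
    and "\<And>n. net_integrable N p D_converges \<Omega> (f n) \<mu>"
    and "order_uniformly_converges \<Omega> f g"
  shows "net_integrable N p D_converges \<Omega> g \<mu> \<and>
    order_converges (\<lambda>n. net_integral N p D_converges \<Omega> (f n) \<mu>)
      (net_integral N p D_converges \<Omega> g \<mu>)"
proof -
  interpret po_integration_structure \<Omega> \<H> N \<eta>\<^sub>1 \<eta>\<^sub>2 D_converges p
    by fact
  obtain u where u: "decreases_to_0 u" "\<And>\<omega> n. \<omega> \<in> \<Omega> \<Longrightarrow> \<bar>f n \<omega> - g \<omega>\<bar> \<le> u n"
    using assms(7) unfolding order_uniformly_converges_def by blast
  obtain l where l: "\<And>n. has_net_integral N p D_converges \<Omega> (f n) \<mu> (l n)"
    using assms(6) unfolding net_integrable_def by metis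
  have "decreases_to_0 (\<lambda>n. p (u n) (\<mu> \<Omega>))"
    using assms(3) by (intro decreases_to_0_product u) blast
  then obtain v where v: "D_converges (gam N \<Omega>) (riemann_sum N p \<Omega> g \<mu>) v" "order_converges l v"
  proof (rule uniform_limit_D_converges[OF assms(2) directed_gam[OF top] l[unfolded has_net_integral_def]])
    show "\<bar>riemann_sum N p \<Omega> (f n) \<mu> \<gamma> - riemann_sum N p \<Omega> g \<mu> \<gamma>\<bar> \<le> p (u n) (\<mu> \<Omega>)"
      if "\<gamma> \<in> Field (gam N \<Omega>)" for n \<gamma>
      by (intro riemann_sum_diff_le assms(3,4) regular_integrator_additive assms(5) top that
          u decreases_to_0_nonneg)
  qed
  have g: "has_net_integral N p D_converges \<Omega> g \<mu> v"
    using v(1) by (simp add: has_net_integral_def)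
  have "(\<lambda>n. net_integral N p D_converges \<Omega> (f n) \<mu>) = l"
    using net_integral_eq[OF top l] by blast
  then show ?thesis
    using v(2) g net_integral_eq[OF top g] by (auto simp: net_integrable_def)
qed

end
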